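(* Let $f\in\mathcal{C}$, where the cone $\mathcal{C}$ (with parameters $\ell_*\in\mathbb{N}$, $\hat\omega$, $\mathring\omega$) is as defined in the context, and let $\ell,m\in\mathbb{N}_0$ satisfy $\ell_*\le\ell\le m$ and $\hat\omega(m-\ell)\,\mathring\omega(m-\ell)<1$. Then $$\left|\int_{[0,1)^d}f(\boldsymbol x)\,d\boldsymbol x-\hat I_m(f)\right|\le\frac{\hat\omega(m)\,\mathring\omega(m-\ell)}{1-\hat\omega(m-\ell)\,\mathring\omega(m-\ell)}\,\widetilde S_{\ell,m}(f).$$
   Context: Let $d\in\mathbb{N}$, let $b$ be a prime number, $\mathbb{N}_0=\{0,1,2,\dots\}$, $\mathbb{N}=\{1,2,\dots\}$, and $\mathbb{F}_n:=\{0,\dots,n-1\}$ (a set of integers). "mod 1" is componentwise; $\boldsymbol x\oplus\boldsymbol y:=(\boldsymbol x+\boldsymbol y)\bmod 1$ on $[0,1)^d$; $\mathrm{i}=\sqrt{-1}$. Embedded rank-1 lattices. Given $\boldsymbol a_0\in\{1,\dots,b-1\}^d$ and $\boldsymbol a_m\in\mathbb{F}_b^d$ for $m\in\mathbb{N}$, set $\boldsymbol z_1=b^{-1}\boldsymbol a_0$ and $\boldsymbol z_{b^m}=b^{-1}(\boldsymbol z_{b^{m-1}}+\boldsymbol a_m)$ for $m\in\mathbb{N}$. Set $\boldsymbol z_0=\boldsymbol 0$ and, for $i\in\mathbb{N}$ with $b$-ary expansion $i=i_0+i_1b+i_2b^2+\cdots$, $\boldsymbol z_i=\sum_{\ell\ge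 0}i_\ell\boldsymbol z_{b^\ell}\bmod 1$. For $\boldsymbol k\in\mathbb{Z}^d$, $\boldsymbol x\in[0,1)^d$ let $\langle\boldsymbol k,\boldsymbol x\rangle:=\boldsymbol k^T\boldsymbol x\bmod 1\in[0,1)$. It is assumed throughout that if $\langle\boldsymbol k,\boldsymbol z_{b^m}\rangle=0$ for all $m\in\mathbb{N}_0$ then $\boldsymbol k=\boldsymbol 0$. Cubature rule. Fix a shift $\boldsymbol\Delta\in[0,1)^d$ and set $\hat I_m(f):=b^{-m}\sum_{i=0}^{b^m-1}f(\boldsymbol z_i\oplus\boldsymbol\Delta)$ for $m\in\mathbb{N}_0$. Wavenumber map. Define $\tilde\nu_m:\mathbb{Z}^d\to\mathbb{F}_{b^m}$ by $\tilde\nu_0(\boldsymbol k):=0$ and $\tilde\nu_m(\boldsymbol k):=b^m\langle\boldsymbol k,\boldsymbol z_{b^{m-1}}\rangle$ for $m\in\mathbb{N}$; for each $\boldsymbol k,m$ one has $\tilde\nu_{m+1}(\boldsymbol k)=\tilde\nu_m(\boldsymbol k)+ab^m$ for a unique $a\in\mathbb{F}_b$. Fix a one-to-one and onto map $\tilde{\boldsymbol k}:\mathbb{N}_0\to\mathbb{Z}^d$ chosen recursively as follows: $\tilde{\boldsymbol k}(0)=\boldsymbol 0$; for each $m\in\mathbb{N}_0$ and $\kappa\in\mathbb{F}_{b^m}$, let $a\in\mathbb{F}_b$ be such that $\tilde\nu_{m+1}(\tilde{\boldsymbol k}(\kappa))=\tilde\nu_m(\tilde{\boldsymbol k}(\kappa))+ab^m$;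 (i) if $a\ne0$, $\tilde{\boldsymbol k}(\kappa+ab^m)$ is some element of $\{\boldsymbol k:\tilde\nu_{m+1}(\boldsymbol k)=\tilde\nu_m(\tilde{\boldsymbol k}(\kappa))\}$; (ii) for each $a'\in\{1,\dots,b-1\}\setminus\{a\}$, $\tilde{\boldsymbol k}(\kappa+a'b^m)$ is some element of $\{\boldsymbol k:\tilde\nu_{m+1}(\boldsymbol k)=\tilde\nu_m(\tilde{\boldsymbol k}(\kappa))+a'b^m\}$. Fourier coefficients. For $f$ on $[0,1)^d$ put $\hat f(\boldsymbol k)=\int_{[0,1)^d}f(\boldsymbol x)e^{-2\pi\mathrm{i}\langle\boldsymbol k,\boldsymbol x\rangle}\,d\boldsymbol x$ and $\tilde f_m(\boldsymbol k):=b^{-m}\sum_{i=0}^{b^m-1}e^{-2\pi\mathrm{i}\langle\boldsymbol k,\boldsymbol z_i\oplus\boldsymbol\Delta\rangle}f(\boldsymbol z_i\oplus\boldsymbol\Delta)$; write $\hat f_\kappa:=\hat f(\tilde{\boldsymbol k}(\kappa))$ and $\tilde f_{m,\kappa}:=\tilde f_m(\tilde{\boldsymbol k}(\kappa))$. For $\ell,m\in\mathbb{N}_0$, $\ell\le m$, define $$S_m(f)=\sum_{\kappa=\lfloor b^{m-1}\rfloor}^{b^m-1}|\hat f_\kappa|,\qquad \widehat S_{\ell,m}(f)=\sum_{\kappa=\lfloor b^{\ell-1}\rfloor}^{b^\ell-1}\sum_{\lambda=1}^\infty|\hat f_{\kappa+\lambda b^m}|,$$ $$\check S_m(f)=\sum_{\kappa=b^m}^\infty|\hat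 f_\kappa|,\qquad \widetilde S_{\ell,m}(f)=\sum_{\kappa=\lfloor b^{\ell-1}\rfloor}^{b^\ell-1}|\tilde f_{m,\kappa}|.$$ Cone. Let $\ell_*\in\mathbb{N}$ and let $\hat\omega,\mathring\omega:\mathbb{N}_0\to[0,\infty)$ be bounded functions such that some $r$ satisfies $\hat\omega(r)\mathring\omega(r)<1$ and $\lim_{m\to\infty}\mathring\omega(m)=0$. Define $$\mathcal{C}:=\{f\in AC([0,1)^d):\ \widehat S_{\ell,m}(f)\le\hat\omega(m-\ell)\check S_m(f)\ \text{for all }\ell\le m;\ \ \check S_m(f)\le\mathring\omega(m-\ell)S_\ell(f)\ \text{for all }\ell_*\le\ell\le m\}.$$ Here $AC([0,1)^d)$ denotes absolutely continuous functions; throughout, integrands are absolutely continuous (in particular continuous) and periodic with period 1 in each variable, with absolutely summable Fourier coefficients, so that $f(\boldsymbol x)=\sum_{\boldsymbol k\in\mathbb{Z}^d}\hat f(\boldsymbol k)e^{2\pi\mathrm{i}\langle\boldsymbol k,\boldsymbol x\rangle}$ for all $\boldsymbol x$. *)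

theory Defs
  imports "HOL-Analysis.Analysis"
begin

subsection \<open>Embedded rank-1 lattices\<close>

definition unit_cube :: "(real ^ 'd) set" where
  "unit_cube = {x. \<forall>j. 0 \<le> x $ j \<and> x $ j < 1}"

definition oplus :: "real ^ 'd \<Rightarrow> real ^ 'd \<Rightarrow> real ^ 'd" where
  "oplus x y = (\<chi> j. frac (x $ j + y $ j))"

text \<open>The bracket \<open>k\<^sup>T x mod 1\<close>.\<close>

definition wn_inner :: "int ^ 'd \<Rightarrow> real ^ 'd \<Rightarrow> real" where
  "wn_inner k x = frac (\<Sum>j\<in>UNIV. real_of_int (k $ j) * x $ j)"

text \<open>\<open>z_pow b a m\<close> is the point with index \<open>b ^ m\<close>; \<open>a\<close> is the generating sequence.\<close>

primrec z_pow :: "nat \<Rightarrow> (nat \<Rightarrow> int ^ 'd) \<Rightarrow> nat \<Rightarrow> real ^ 'd" where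
  "z_pow b a 0 = (\<chi> j. real_of_int (a 0 $ j) / real b)"
| "z_pow b a (Suc m) = (\<chi> j. (z_pow b a m $ j + real_of_int (a (Suc m) $ j)) / real b)"

definition digit :: "nat \<Rightarrow> nat \<Rightarrow> nat \<Rightarrow> nat" where
  "digit b i l = i div b ^ l mod b"

text \<open>The digit sum only runs over the (for \<open>b \<ge> 2\<close>, finitely many) nonzero digits; in
  particular \<open>z_pt b a 0 = 0\<close>.\<close>

definition z_pt :: "nat \<Rightarrow> (nat \<Rightarrow> int ^ 'd) \<Rightarrow> nat \<Rightarrow> real ^ 'd" where
  "z_pt b a i = (\<chi> j. frac (\<Sum>l | digit b i l \<noteq> 0. real (digit b i l) * z_pow b a l $ j))"

definition lattice_generator :: "nat \<Rightarrow> (nat \<Rightarrow> int ^ 'd) \<Rightarrow> bool" where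
  "lattice_generator b a \<longleftrightarrow>
     (\<forall>j. a 0 $ j \<in> {1..int b - 1}) \<and>
     (\<forall>m\<ge>1. \<forall>j. a m $ j \<in> {0..int b - 1}) \<and>
     (\<forall>k :: int ^ 'd. (\<forall>m. wn_inner k (z_pow b a m) = 0) \<longrightarrow> k = 0)"

definition cubature ::
  "nat \<Rightarrow> (nat \<Rightarrow> int ^ 'd) \<Rightarrow> real ^ 'd \<Rightarrow> nat \<Rightarrow> (real ^ 'd \<Rightarrow> complex) \<Rightarrow> complex" where
  "cubature b a \<Delta> m f = (\<Sum>i<b ^ m. f (oplus (z_pt b a i) \<Delta>)) / of_nat (b ^ m)"


subsection \<open>The wavenumber map\<close>

text \<open>The floor is exact, and the values lie below \<open>b ^ m\<close>: see \<open>nu_Suc\<close> and \<open>nu_less\<close> below.\<close>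

definition nu :: "nat \<Rightarrow> (nat \<Rightarrow> int ^ 'd) \<Rightarrow> nat \<Rightarrow> int ^ 'd \<Rightarrow> nat" where
  "nu b a m k = (case m of 0 \<Rightarrow> 0 | Suc n \<Rightarrow> nat \<lfloor>real (b ^ m) * wn_inner k (z_pow b a n)\<rfloor>)"

definition wavenumber_map :: "nat \<Rightarrow> (nat \<Rightarrow> int ^ 'd) \<Rightarrow> (nat \<Rightarrow> int ^ 'd) \<Rightarrow> bool" where
  "wavenumber_map b a kt \<longleftrightarrow>
     bij kt \<and> kt 0 = 0 \<and>
     (\<forall>m. \<forall>\<kappa><b ^ m. \<exists>c<b.
        nu b a (Suc m) (kt \<kappa>) = nu b a m (kt \<kappa>) + c * b ^ m \<and>
        (c \<noteq> 0 \<longrightarrow> nu b a (Suc m) (kt (\<kappa> + c * b ^ m)) = nu b a m (kt \<kappa>)) \<and>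
        (\<forall>c'\<in>{1..b - 1} - {c}.
           nu b a (Suc m) (kt (\<kappa> + c' * b ^ m)) = nu b a m (kt \<kappa>) + c' * b ^ m))"

lemma z_pow_int:
  assumes "b > 0"
  shows "real (b ^ Suc m) * z_pow b a m $ j \<in> \<int>"
proof (induction m)
  case 0
  then show ?case using assms by simp
next
  case (Suc m)
  have "real (b ^ Suc (Suc m)) * z_pow b a (Suc m) $ j
      = real (b ^ Suc m) * z_pow b a m $ j + of_int (int (b ^ Suc m) * a (Suc m) $ j)"
    using assms by (simp add: field_simps)
  then show ?case using Suc by (metis Ints_add Ints_of_int)
qed

lemma nu_0: "nu b a 0 k = 0"
  by (simp add: nu_def)

lemma nu_Suc:
  assumes "b > 0"
  shows "real (nu b a (Suc m) k) = real (b ^ Suc m) * wn_inner k (z_pow b a m)"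
proof -
  define s where "s = (\<Sum>j\<in>UNIV. real_of_int (k $ j) * z_pow b a m $ j)"
  have "real (b ^ Suc m) * s
      = (\<Sum>j\<in>UNIV. real_of_int (k $ j) * (real (b ^ Suc m) * z_pow b a m $ j))"
    unfolding s_def sum_distrib_left by (intro sum.cong) (auto simp: algebra_simps)
  also have "\<dots> \<in> \<int>"
    by (intro Ints_sum Ints_mult Ints_of_int z_pow_int assms)
  finally have "real (b ^ Suc m) * s - of_int (int (b ^ Suc m) * \<lfloor>s\<rfloor>) \<in> \<int>"
    by (intro Ints_diff Ints_of_int)
  moreover have eq: "real (b ^ Suc m) * s - of_int (int (b ^ Suc m) * \<lfloor>s\<rfloor>)
      = real (b ^ Suc m) * wn_inner k (z_pow b a m)"
    by (simp only: wn_inner_def s_def[symmetric] frac_def of_int_mult right_diff_distrib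
        of_int_of_nat_eq)
  ultimately have "real (b ^ Suc m) * wn_inner k (z_pow b a m) \<in> \<int>"
    by (simp only:)
  then obtain n where n: "real (b ^ Suc m) * wn_inner k (z_pow b a m) = of_int n"
    by (rule Ints_cases)
  have "0 \<le> real (b ^ Suc m) * wn_inner k (z_pow b a m)"
    unfolding wn_inner_def by (intro mult_nonneg_nonneg) (auto simp: frac_ge_0)
  then have "0 \<le> n" unfolding n by simp
  have "nu b a (Suc m) k = nat n"
    unfolding nu_def nat.case n by simp
  then show ?thesis unfolding n using \<open>0 \<le> n\<close> by simp
qed

lemma nu_less:
  assumes "b > 0"
  shows "nu b a m k < b ^ m"
proof (cases m)
  case (Suc n)
  have "real (nu b a (Suc n) k) < real (b ^ Suc n) * 1"
    unfolding nu_Suc[OF assms] wn_inner_def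
    using assms by (intro mult_strict_left_mono frac_lt_1) simp
  then show ?thesis unfolding Suc mult_1_right by (simp only: of_nat_less_iff)
qed (simp add: nu_0)


subsection \<open>Absolute continuity\<close>

definition absolutely_continuous_fun_on ::
  "real \<Rightarrow> real \<Rightarrow> (real \<Rightarrow> 'a::real_normed_vector) \<Rightarrow> bool" where
  "absolutely_continuous_fun_on p q g \<longleftrightarrow>
     (\<forall>\<epsilon>>0. \<exists>\<delta>>0. \<forall>I :: (real \<times> real) set.
        finite I \<and> (\<forall>(u, v)\<in>I. p \<le> u \<and> u \<le> v \<and> v \<le> q) \<and>
        disjoint_family_on (\<lambda>(u, v). {u<..<v}) I \<and> (\<Sum>(u, v)\<in>I. v - u) < \<delta>
        \<longrightarrow> (\<Sum>(u, v)\<in>I. norm (g v - g u)) < \<epsilon>)"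

text \<open>Absolute continuity of a function of several variables is read as: continuous, and
  absolutely continuous on almost every line segment parallel to a coordinate axis. For
  dimension one this is the classical notion; the stronger multivariate notions (in
  the sense of Tonelli, or of Hardy and Krause) imply it.\<close>

definition absolutely_continuous_cube :: "(real ^ 'd \<Rightarrow> complex) \<Rightarrow> bool" where
  "absolutely_continuous_cube f \<longleftrightarrow>
     continuous_on UNIV f \<and>
     (\<forall>j. AE x in lborel.
        absolutely_continuous_fun_on 0 1 (\<lambda>t. f (\<chi> i. if i = j then t else x $ i)))"


subsection \<open>Fourier coefficients\<close>

definition fourier_coeff :: "(real ^ 'd \<Rightarrow> complex) \<Rightarrow> int ^ 'd \<Rightarrow> complex" where
  "fourier_coeff f k =
     (LINT x:unit_cube|lborel. f x * exp (- (2 * complex_of_real pi * \<i> * of_real (wn_inner k x))))"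

definition discrete_coeff ::
  "nat \<Rightarrow> (nat \<Rightarrow> int ^ 'd) \<Rightarrow> real ^ 'd \<Rightarrow> nat \<Rightarrow> (real ^ 'd \<Rightarrow> complex) \<Rightarrow> int ^ 'd \<Rightarrow> complex"
  where
  "discrete_coeff b a \<Delta> m f k =
     (\<Sum>i<b ^ m. exp (- (2 * complex_of_real pi * \<i> *
                         of_real (wn_inner k (oplus (z_pt b a i) \<Delta>)))) *
                f (oplus (z_pt b a i) \<Delta>)) / of_nat (b ^ m)"

definition integrand :: "(real ^ 'd \<Rightarrow> complex) \<Rightarrow> bool" where
  "integrand f \<longleftrightarrow>
     absolutely_continuous_cube f \<and>
     (\<forall>x j. f (x + axis j 1) = f x) \<and>
     (\<lambda>k. norm (fourier_coeff f k)) summable_on UNIV"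

text \<open>The block of indices from \<open>\<lfloor>b\<^bsup>l-1\<^esup>\<rfloor>\<close> to \<open>b\<^bsup>l\<^esup> - 1\<close>; for \<open>l = 0\<close> it is \<open>{0}\<close>.\<close>

definition block :: "nat \<Rightarrow> nat \<Rightarrow> nat set" where
  "block b l = {nat \<lfloor>real b powi (int l - 1)\<rfloor> .. b ^ l - 1}"

definition S_sum :: "nat \<Rightarrow> (nat \<Rightarrow> int ^ 'd) \<Rightarrow> nat \<Rightarrow> (real ^ 'd \<Rightarrow> complex) \<Rightarrow> real" where
  "S_sum b kt m f = (\<Sum>\<kappa>\<in>block b m. norm (fourier_coeff f (kt \<kappa>)))"

definition S_hat :: "nat \<Rightarrow> (nat \<Rightarrow> int ^ 'd) \<Rightarrow> nat \<Rightarrow> nat \<Rightarrow> (real ^ 'd \<Rightarrow> complex) \<Rightarrow> real" where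
  "S_hat b kt l m f =
     (\<Sum>\<kappa>\<in>block b l. \<Sum>\<^sub>\<infinity>n\<in>{1..}. norm (fourier_coeff f (kt (\<kappa> + n * b ^ m))))"

definition S_check :: "nat \<Rightarrow> (nat \<Rightarrow> int ^ 'd) \<Rightarrow> nat \<Rightarrow> (real ^ 'd \<Rightarrow> complex) \<Rightarrow> real" where
  "S_check b kt m f = (\<Sum>\<^sub>\<infinity>\<kappa>\<in>{b ^ m..}. norm (fourier_coeff f (kt \<kappa>)))"

definition S_tilde ::
  "nat \<Rightarrow> (nat \<Rightarrow> int ^ 'd) \<Rightarrow> real ^ 'd \<Rightarrow> (nat \<Rightarrow> int ^ 'd) \<Rightarrow> nat \<Rightarrow> nat \<Rightarrow>
   (real ^ 'd \<Rightarrow> complex) \<Rightarrow> real" where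
  "S_tilde b a \<Delta> kt l m f = (\<Sum>\<kappa>\<in>block b l. norm (discrete_coeff b a \<Delta> m f (kt \<kappa>)))"


subsection \<open>The cone\<close>

definition cone_parameters :: "nat \<Rightarrow> (nat \<Rightarrow> real) \<Rightarrow> (nat \<Rightarrow> real) \<Rightarrow> bool" where
  "cone_parameters lstar \<omega>hat \<omega>ring \<longleftrightarrow>
     1 \<le> lstar \<and>
     (\<forall>n. 0 \<le> \<omega>hat n) \<and> bounded (range \<omega>hat) \<and>
     (\<forall>n. 0 \<le> \<omega>ring n) \<and> bounded (range \<omega>ring) \<and>
     (\<exists>r. \<omega>hat r * \<omega>ring r < 1) \<and> \<omega>ring \<longlonglongrightarrow> 0"

definition integrand_cone ::
  "nat \<Rightarrow> (nat \<Rightarrow> int ^ 'd) \<Rightarrow> nat \<Rightarrow> (nat \<Rightarrow> real) \<Rightarrow> (nat \<Rightarrow> real) \<Rightarrow>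
   (real ^ 'd \<Rightarrow> complex) set" where
  "integrand_cone b kt lstar \<omega>hat \<omega>ring =
     {f. integrand f \<and>
         (\<forall>l m. l \<le> m \<longrightarrow> S_hat b kt l m f \<le> \<omega>hat (m - l) * S_check b kt m f) \<and>
         (\<forall>l m. lstar \<le> l \<and> l \<le> m \<longrightarrow> S_check b kt m f \<le> \<omega>ring (m - l) * S_sum b kt l f)}"

end

theory Submission
  imports Defs
begin

text \<open>
  A continuous periodic function with absolutely summable Fourier coefficients is the sum of its
  Fourier series. Summing the series over the lattice annihilates every term whose frequency differs
  from \<open>kt \<kappa>\<close> by an element outside the dual lattice of level \<open>m\<close>, and the frequencies that survive
  are exactly \<open>kt (\<kappa> + n b\<^sup>m)\<close>. Hence the discrete coefficient with index \<open>\<kappa>\<close> differs from the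
  true one by at most the sum of the absolute values of the coefficients aliased with it. For
  \<open>\<kappa> = 0\<close> this bounds the cubature error by \<open>S_hat 0 m\<close>, hence through the cone conditions by
  \<open>\<omega>hat m * \<omega>ring (m - l) * S_sum l\<close>; summed over the block of level \<open>l\<close> it gives
  \<open>S_sum l \<le> S_tilde l m + \<omega>hat (m - l) * \<omega>ring (m - l) * S_sum l\<close>, which is solved for \<open>S_sum l\<close>.
\<close>

subsection \<open>Characters of the torus\<close>

text \<open>The inner product is not reduced modulo 1, so that multiplicativity in both arguments
  follows from \<open>cis_mult\<close>. By \<open>exp_wn_inner\<close> the conjugate is the kernel
  of the Fourier coefficients.\<close>

definition torus_char :: "int ^ 'd \<Rightarrow> real ^ 'd \<Rightarrow> complex" where
  "torus_char k x = cis (2 * pi * (\<Sum>j\<in>UNIV. real_of_int (k $ j) * x $ j))"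

lemma norm_torus_char [simp]: "norm (torus_char k x) = 1"
  by (simp add: torus_char_def)

lemma torus_char_0 [simp]: "torus_char 0 x = 1"
  by (simp add: torus_char_def)

lemma torus_char_add_left: "torus_char (k + h) x = torus_char k x * torus_char h x"
  by (simp add: torus_char_def cis_mult algebra_simps sum.distrib)

lemma torus_char_add_right: "torus_char k (x + y) = torus_char k x * torus_char k y"
  by (simp add: torus_char_def cis_mult algebra_simps sum.distrib)

lemma torus_char_uminus: "torus_char (- k) x = cnj (torus_char k x)"
  by (simp add: torus_char_def cis_cnj sum_negf)

lemma torus_char_diff: "torus_char (k - h) x = torus_char k x * cnj (torus_char h x)"
  using torus_char_add_left[of k "- h" x] by (simp add: torus_char_uminus)

lemma torus_char_axis_left: "torus_char (axis j 1) x = cis (2 * pi * x $ j)"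
proof -
  have "(\<Sum>i\<in>UNIV. real_of_int (axis j 1 $ i) * x $ i) = (\<Sum>i\<in>UNIV. if i = j then x $ j else 0)"
    by (intro sum.cong) (auto simp: axis_def)
  then show ?thesis by (simp add: torus_char_def)
qed

lemma torus_char_axis_right: "torus_char k (axis j t) = cis (2 * pi * (real_of_int (k $ j) * t))"
proof -
  have "(\<Sum>i\<in>UNIV. real_of_int (k $ i) * axis j t $ i) = (\<Sum>i\<in>UNIV. if i = j then real_of_int (k $ j) * t else 0)"
    by (intro sum.cong) (auto simp: axis_def)
  then show ?thesis by (simp add: torus_char_def)
qed

lemma continuous_on_torus_char [continuous_intros]: "continuous_on A (torus_char k)"
  unfolding torus_char_def by (intro continuous_intros)

lemma cis_frac: "cis (2 * pi * frac s) = cis (2 * pi * s)"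
proof -
  have "cis (2 * pi * s) = cis (2 * pi * frac s) * cis (2 * pi * of_int \<lfloor>s\<rfloor>)"
    by (simp add: cis_mult frac_def algebra_simps)
  then show ?thesis by (simp add: cis_multiple_2pi)
qed

text \<open>The floors removed from x change the inner product by an integer, because
  \<open>k\<close> is an integer vector.\<close>

lemma torus_char_frac: "torus_char k (\<chi> j. frac (x $ j)) = torus_char k x"
proof -
  have "(\<Sum>j\<in>UNIV. real_of_int (k $ j) * x $ j)
     = (\<Sum>j\<in>UNIV. real_of_int (k $ j) * frac (x $ j)) + of_int (\<Sum>j\<in>UNIV. k $ j * \<lfloor>x $ j\<rfloor>)"
    by (simp add: frac_def algebra_simps sum_subtractf)
  then have "torus_char k x = torus_char k (\<chi> j. frac (x $ j)) * cis (2 * pi * of_int (\<Sum>j\<in>UNIV. k $ j * \<lfloor>x $ j\<rfloor>))"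
    by (simp only: torus_char_def cis_mult distrib_left vec_lambda_beta)
  then show ?thesis by (simp add: cis_multiple_2pi del: of_int_sum)
qed

lemma torus_char_oplus: "torus_char k (oplus x y) = torus_char k x * torus_char k y"
  using torus_char_frac[of k "x + y"] by (simp add: oplus_def torus_char_add_right)

lemma exp_wn_inner: "exp (- (2 * complex_of_real pi * \<i> * of_real (wn_inner k x))) = cnj (torus_char k x)"
proof -
  have "torus_char k x = cis (2 * pi * wn_inner k x)"
    by (simp add: torus_char_def wn_inner_def cis_frac)
  moreover have "cis (2 * pi * wn_inner k x) = exp (2 * complex_of_real pi * \<i> * of_real (wn_inner k x))"
    by (simp add: cis_conv_exp mult_ac)
  ultimately show ?thesis by (simp add: exp_cnj)
qed


subsection \<open>Integration over the unit cube\<close>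

definition periodic :: "(real ^ 'd \<Rightarrow> 'a) \<Rightarrow> bool" where
  "periodic g \<longleftrightarrow> (\<forall>x j. g (x + axis j 1) = g x)"

lemma periodic_torus_char: "periodic (torus_char k)"
  by (simp add: periodic_def torus_char_add_right torus_char_axis_right cis_multiple_2pi)

text \<open>Iterating the unit shift gives natural multiples, shifting back gives negative ones, and
  the coordinates are then treated one at a time.\<close>

lemma periodic_int_shift:
  assumes "periodic g"
  shows "g (x + (\<chi> j. of_int (k $ j))) = g x"
proof -
  have nat: "g (x + axis j (real n)) = g x" for x j n
  proof (induction n)
    case 0 then show ?case by (simp add: axis_def vec_eq_iff flip: zero_vec_def)
  next
    case (Suc n)
    have "x + axis j (real (Suc n)) = (x + axis j (real n)) + axis j 1"
      by (simp add: vec_eq_iff axis_def)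
    then show ?case using assms Suc unfolding periodic_def by metis
  qed
  have int: "g (x + axis j (real_of_int n)) = g x" for x j n
  proof (cases "n \<ge> 0")
    case True then show ?thesis using nat[of x j "nat n"] by simp
  next
    case False
    have "x = (x + axis j (real_of_int n)) + axis j (real (nat (- n)))"
      using False by (simp add: vec_eq_iff axis_def)
    then show ?thesis using nat by metis
  qed
  have "g (x + (\<Sum>j\<in>A. axis j (of_int (k $ j)))) = g x" if "finite A" for A
    using that
  proof (induction A)
    case (insert j A)
    then show ?case using int[of "x + (\<Sum>j\<in>A. axis j (of_int (k $ j)))" j "k $ j"]
      by (simp add: algebra_simps)
  qed simp
  moreover have "(\<Sum>j\<in>UNIV. axis j (real_of_int (k $ j))) = (\<chi> j. of_int (k $ j))"
    by (simp add: vec_eq_iff axis_def sum.If_cases flip: sum.delta)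
  ultimately show ?thesis by (metis finite)
qed

lemma periodic_eq_frac:
  assumes "periodic g"
  shows "g x = g (\<chi> j. frac (x $ j))"
  using periodic_int_shift[OF assms, of "\<chi> j. frac (x $ j)" "\<chi> j. \<lfloor>x $ j\<rfloor>"]
  by (simp add: plus_vec_def frac_def)

lemma frac_in_unit_cube: "(\<chi> j. frac (x $ j)) \<in> unit_cube"
  by (simp add: unit_cube_def frac_lt_1)

lemma unit_cube_subset_cbox: "unit_cube \<subseteq> cbox 0 (1 :: real ^ 'd)"
  by (auto simp: unit_cube_def mem_box_cart less_imp_le)

lemma box_subset_unit_cube: "box 0 (1 :: real ^ 'd) \<subseteq> unit_cube"
  by (auto simp: unit_cube_def mem_box_cart less_imp_le)

lemma unit_cube_borel [measurable]: "(unit_cube :: (real ^ 'd) set) \<in> sets borel"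
proof -
  have "(unit_cube :: (real ^ 'd) set) = (\<Inter>j. {x. 0 \<le> x $ j \<and> x $ j < 1})"
    by (auto simp: unit_cube_def)
  also have "\<dots> \<in> sets borel"
    by (intro sets.countable_INT'') auto
  finally show ?thesis .
qed

text \<open>The half-open cube is squeezed between the open and the closed box, both of volume
  1.\<close>

lemma emeasure_unit_cube: "emeasure lborel (unit_cube :: (real ^ 'd) set) = 1"
proof -
  have 1: "(\<Prod>b\<in>Basis. ((1 :: real ^ 'd) - 0) \<bullet> b) = 1"
    by (intro prod.neutral) (auto simp: Basis_vec_def inner_axis)
  have "emeasure lborel (box 0 (1 :: real ^ 'd)) = 1" "emeasure lborel (cbox 0 (1 :: real ^ 'd)) = 1"
    using 1 by (auto simp: emeasure_lborel_box_eq emeasure_lborel_cbox_eq Basis_vec_def inner_axis)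
  moreover have "emeasure lborel (box 0 (1 :: real ^ 'd)) \<le> emeasure lborel (unit_cube :: (real ^ 'd) set)"
    by (rule emeasure_mono[OF box_subset_unit_cube]) simp
  moreover have "emeasure lborel (unit_cube :: (real ^ 'd) set) \<le> emeasure lborel (cbox 0 (1 :: real ^ 'd))"
    by (rule emeasure_mono[OF unit_cube_subset_cbox]) simp
  ultimately show ?thesis by (metis antisym)
qed

lemma set_integrable_unit_cube:
  fixes g :: "real ^ 'd \<Rightarrow> 'a :: {banach, second_countable_topology}"
  assumes "continuous_on UNIV g"
  shows "set_integrable lborel unit_cube g"
proof (rule set_integrable_subset)
  show "set_integrable lborel (cbox 0 1) g"
    unfolding set_integrable_def
    by (intro borel_integrable_compact compact_cbox continuous_on_subset[OF assms]) auto
qed (use unit_cube_subset_cbox in auto)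

lemma lborel_integral_shift:
  fixes g :: "'a :: euclidean_space \<Rightarrow> 'b :: {banach, second_countable_topology}"
  assumes [measurable]: "g \<in> borel_measurable borel"
  shows "integral\<^sup>L lborel (\<lambda>x. g (c + x)) = integral\<^sup>L lborel g"
proof -
  have "integral\<^sup>L lborel g = integral\<^sup>L (distr lborel borel ((+) c)) g"
    by (simp add: lborel_distr_plus)
  also have "\<dots> = integral\<^sup>L lborel (\<lambda>x. g (c + x))"
    by (rule integral_distr) auto
  finally show ?thesis by simp
qed

text \<open>The part of the shifted cube above the hyperplane \<open>x\<^sub>j = 1\<close> is moved back by a full period.\<close>

lemma set_integral_periodic_shift:
  fixes g :: "real ^ 'd \<Rightarrow> complex"
  assumes cont: "continuous_on UNIV g" and per: "periodic g" and t: "0 \<le> t" "t < 1"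
  shows "(LINT x:unit_cube|lborel. g (axis j t + x)) = (LINT x:unit_cube|lborel. g x)"
proof -
  have [measurable]: "g \<in> borel_measurable borel"
    using cont by (rule borel_measurable_continuous_onI)
  define A where "A = {x \<in> unit_cube :: (real ^ 'd) set. x $ j < t}"
  define B where "B = {x \<in> unit_cube :: (real ^ 'd) set. t \<le> x $ j}"
  \<comment> \<open>\<open>A'\<close> is \<open>A\<close> translated by \<open>axis j 1\<close>. It
    is disjoint from \<open>B\<close>, and together they form the cube translated by
    \<open>axis j t\<close>.\<close>
  define A' where "A' = (\<lambda>x. x - axis j 1) -` A"
  have [measurable]: "A \<in> sets borel" "B \<in> sets borel"
    unfolding A_def B_def by measurable
  have [measurable]: "A' \<in> sets borel"
    unfolding A'_def by (rule measurable_sets_borel[of _ borel]) auto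
  have gp: "g (axis j 1 + x) = g x" for x
    using per by (simp add: periodic_def add.commute)
  have intg: "set_integrable lborel A g" "set_integrable lborel B g"
    by (rule set_integrable_subset[OF set_integrable_unit_cube[OF cont]]; auto simp: A_def B_def)+
  have ind: "indicator A' (axis j 1 + x) = (indicator A x :: real)" for x
    by (simp add: A'_def indicator_def)
  have A': "integral\<^sup>L lborel (\<lambda>x. indicator A' x *\<^sub>R g x) = integral\<^sup>L lborel (\<lambda>x. indicator A x *\<^sub>R g x)"
    using lborel_integral_shift[of "\<lambda>x. indicator A' x *\<^sub>R g x" "axis j 1"] by (simp add: gp ind)
  have intA': "integrable lborel (\<lambda>x. indicator A' x *\<^sub>R g x)"
  proof -
    have "integrable (distr lborel borel ((+) (axis j 1))) (\<lambda>x. indicator A' x *\<^sub>R g x)"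
      using intg(1) by (subst integrable_distr_eq) (auto simp: gp ind set_integrable_def)
    then show ?thesis by (simp add: lborel_distr_plus)
  qed
  have split: "indicator unit_cube x *\<^sub>R g (axis j t + x)
      = indicator A' (axis j t + x) *\<^sub>R g (axis j t + x) + indicator B (axis j t + x) *\<^sub>R g (axis j t + x)" for x
  proof -
    have cube: "y \<in> unit_cube \<longleftrightarrow> (0 \<le> y $ j \<and> y $ j < 1) \<and> (\<forall>i. i \<noteq> j \<longrightarrow> 0 \<le> y $ i \<and> y $ i < 1)"
      for y :: "real ^ 'd"
      unfolding unit_cube_def by auto
    have off: "i \<noteq> j \<Longrightarrow> axis j c $ i = (0 :: real)" and on: "axis j c $ j = (c :: real)" for i c
      by (simp_all add: axis_def)
    have i: "axis j t + x - axis j 1 \<in> A \<longleftrightarrow> x \<in> unit_cube \<and> 1 - t \<le> x $ j"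
      unfolding A_def mem_Collect_eq cube using t by (auto simp: on off)
    have ii: "axis j t + x \<in> B \<longleftrightarrow> x \<in> unit_cube \<and> x $ j < 1 - t"
      unfolding B_def mem_Collect_eq cube using t by (auto simp: on off)
    show ?thesis using i ii by (auto simp: indicator_def A'_def)
  qed
  have "(LINT x:unit_cube|lborel. g (axis j t + x))
    = integral\<^sup>L lborel (\<lambda>x. indicator A' (axis j t + x) *\<^sub>R g (axis j t + x) + indicator B (axis j t + x) *\<^sub>R g (axis j t + x))"
    by (simp add: set_lebesgue_integral_def split)
  also have "\<dots> = integral\<^sup>L lborel (\<lambda>x. indicator A' x *\<^sub>R g x + indicator B x *\<^sub>R g x)"
    by (rule lborel_integral_shift) measurable
  also have "\<dots> = integral\<^sup>L lborel (\<lambda>x. indicator A x *\<^sub>R g x + indicator B x *\<^sub>R g x)"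
    using intg intA' A' by (simp add: set_integrable_def)
  also have "\<dots> = (LINT x:unit_cube|lborel. g x)"
    unfolding set_lebesgue_integral_def
    by (intro Bochner_Integration.integral_cong refl) (auto simp: A_def B_def indicator_def)
  finally show ?thesis .
qed

text \<open>Shifting by half a period of a nontrivial character changes its sign.\<close>

lemma integral_torus_char: "(LINT x:unit_cube|lborel. torus_char (k :: int ^ 'd) x) = (if k = 0 then 1 else 0)"
proof (cases "k = 0")
  case True
  then show ?thesis
    by (simp add: set_lebesgue_integral_def measure_def emeasure_unit_cube)
next
  case False
  then obtain j where j: "k $ j \<noteq> 0" by (auto simp: vec_eq_iff)
  \<comment> \<open>The argument of the character at \<open>axis j t\<close> is then pi or - pi,
    according to the sign of \<open>k $ j\<close>. As \<open>k $ j\<close> is a nonzero integer, t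
    is at most 1/2.\<close>
  define t :: real where "t = 1 / (2 * \<bar>real_of_int (k $ j)\<bar>)"
  have t: "0 \<le> t" "t < 1" using j by (auto simp: t_def field_simps)
  have "torus_char k (axis j t) = -1"
  proof (cases "k $ j > 0")
    case True then show ?thesis by (simp add: torus_char_axis_right t_def)
  next
    case False
    have "cis (- pi) = -1" by (simp add: complex_eq_iff)
    with False j show ?thesis by (simp add: torus_char_axis_right t_def)
  qed
  then have "(LINT x:unit_cube|lborel. torus_char k x) = (LINT x:unit_cube|lborel. - torus_char k x)"
    using set_integral_periodic_shift[OF continuous_on_torus_char periodic_torus_char t, of k j]
    by (simp add: torus_char_add_right)
  then have "(LINT x:unit_cube|lborel. torus_char k x) = - (LINT x:unit_cube|lborel. torus_char k x)"
    by (simp add: set_lebesgue_integral_def)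
  then show ?thesis using False by simp
qed


subsection \<open>Fourier inversion\<close>

inductive_set trig_poly :: "(real ^ 'd \<Rightarrow> complex) set" where
  torus_char: "(\<lambda>x. c * torus_char k x) \<in> trig_poly"
| add: "p \<in> trig_poly \<Longrightarrow> q \<in> trig_poly \<Longrightarrow> (\<lambda>x. p x + q x) \<in> trig_poly"

text \<open>Products of characters are characters. This closure makes the trigonometric polynomials
  an algebra, as Stone--Weierstrass requires.\<close>

lemma trig_poly_mult:
  assumes "p \<in> trig_poly" "q \<in> trig_poly"
  shows "(\<lambda>x. p x * q x) \<in> trig_poly"
  using assms(1)
proof induction
  case (torus_char c k)
  from assms(2) show ?case
  proof induction
    case (torus_char d h)
    have "(\<lambda>x. c * torus_char k x * (d * torus_char h x)) = (\<lambda>x. (c * d) * torus_char (k + h) x)"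
      by (simp add: torus_char_add_left mult_ac)
    then show ?case by (simp only: trig_poly.torus_char)
  next
    case (add p q)
    then show ?case by (simp add: distrib_left trig_poly.add)
  qed
next
  case (add p p')
  then show ?case by (simp add: distrib_right trig_poly.add)
qed

lemma trig_poly_const: "(\<lambda>x. c) \<in> trig_poly"
  using trig_poly.torus_char[of c 0] by simp

lemma continuous_on_trig_poly: "p \<in> trig_poly \<Longrightarrow> continuous_on A p"
  by (induction rule: trig_poly.induct) (auto intro!: continuous_intros)

text \<open>Periodic functions do not separate the points of the cube, so the Stone--Weierstrass theorem is
  applied on the torus, seen as a compact subset of \<open>complex ^ 'd\<close>.\<close>

definition torus_map :: "real ^ 'd \<Rightarrow> complex ^ 'd" where
  "torus_map x = (\<chi> j. cis (2 * pi * x $ j))"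

lemma continuous_on_torus_map: "continuous_on A torus_map"
  unfolding torus_map_def by (intro continuous_intros)

text \<open>Cosine and sine determine an angle up to multiples of 2 pi, so points with the same
  image differ by an integer vector.\<close>

lemma torus_map_eqD:
  assumes "periodic g" "torus_map x = torus_map y"
  shows "g x = g y"
proof -
  have "\<exists>n :: int. x $ j = y $ j + of_int n" for j
  proof -
    have "cis (2 * pi * x $ j) = cis (2 * pi * y $ j)"
      using assms(2) by (simp add: torus_map_def vec_eq_iff)
    then have "cos (2 * pi * x $ j) = cos (2 * pi * y $ j)" "sin (2 * pi * x $ j) = sin (2 * pi * y $ j)"
      by (simp_all add: complex_eq_iff)
    then obtain n :: int where "2 * pi * x $ j = 2 * pi * y $ j + 2 * pi * of_int n"
      using sin_cos_eq_iff by metis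
    then have "2 * pi * x $ j = 2 * pi * (y $ j + of_int n)" by (simp add: algebra_simps)
    then show ?thesis by auto
  qed
  then obtain n :: "'a \<Rightarrow> int" where "\<And>j. x $ j = y $ j + of_int (n j)" by metis
  then have "x = y + (\<chi> j. of_int ((\<chi> j. n j) $ j))" by (simp add: vec_eq_iff)
  then show ?thesis using periodic_int_shift[OF assms(1)] by metis
qed

lemma range_torus_map: "range (torus_map :: real ^ 'd \<Rightarrow> _) = torus_map ` cbox 0 1"
proof -
  have "torus_map x = torus_map (\<chi> j. frac (x $ j))" for x :: "real ^ 'd"
    by (simp add: torus_map_def cis_frac)
  moreover have "(\<chi> j. frac (x $ j)) \<in> cbox 0 1" for x :: "real ^ 'd"
    using frac_in_unit_cube unit_cube_subset_cbox by blast
  ultimately show ?thesis by blast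
qed

text \<open>Restricted to the closed cube, \<open>torus_map\<close> is a continuous surjection from
  a compact space onto a Hausdorff space, hence a quotient map. Continuity on the torus can
  therefore be tested after composing with it.\<close>

lemma continuous_factor_torus:
  fixes \<phi> :: "real ^ 'd \<Rightarrow> 'b :: topological_space"
  assumes "continuous_on UNIV \<phi>" "periodic \<phi>"
  obtains \<Phi> where "continuous_on (range torus_map) \<Phi>" "\<And>x. \<Phi> (torus_map x) = \<phi> x"
proof -
  \<comment> \<open>The choice of preimage is immaterial, since \<phi> is constant on the fibres of
    \<open>torus_map\<close>.\<close>
  define \<Phi> where "\<Phi> w = \<phi> (SOME x. torus_map x = w)" for w
  have \<Phi>: "\<Phi> (torus_map x) = \<phi> x" for x
    unfolding \<Phi>_def by (rule torus_map_eqD[OF assms(2)]) (rule someI[of _ x], rule refl)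
  have "quotient_map (top_of_set (cbox 0 1)) (top_of_set (range torus_map)) (torus_map :: real ^ 'd \<Rightarrow> _)"
  proof (rule T1_Spaces.continuous_imp_quotient_map)
    show "continuous_map (top_of_set (cbox 0 1)) (top_of_set (range torus_map)) (torus_map :: real ^ 'd \<Rightarrow> _)"
      by (auto simp: continuous_on_torus_map)
    show "compact_space (top_of_set (cbox 0 (1 :: real ^ 'd)))"
      by (simp add: compact_space_subtopology)
    show "Hausdorff_space (top_of_set (range (torus_map :: real ^ 'd \<Rightarrow> _)))"
      by (simp add: Hausdorff_space_subtopology)
  qed (simp add: range_torus_map)
  moreover have "continuous_map (top_of_set (cbox 0 1)) euclidean (\<Phi> \<circ> torus_map)"
    using continuous_on_subset[OF assms(1), of "cbox 0 1"] by (simp add: \<Phi> o_def)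
  ultimately have "continuous_map (top_of_set (range torus_map)) euclidean \<Phi>"
    by (rule continuous_compose_quotient_map)
  then show thesis using that \<Phi> by simp
qed

lemma trig_poly_approx:
  fixes \<phi> :: "real ^ 'd \<Rightarrow> real"
  assumes "continuous_on UNIV \<phi>" "periodic \<phi>" "e > 0"
  obtains p where "p \<in> trig_poly" "\<And>x. norm (of_real (\<phi> x) - p x) < e"
proof -
  let ?T = "range (torus_map :: real ^ 'd \<Rightarrow> _)"
  \<comment> \<open>\<open>R\<close> is the real algebra for Stone--Weierstrass: continuous
    functions on the torus whose pullbacks are trigonometric polynomials. The real and imaginary
    parts of the coordinates belong to it and separate points.\<close>
  define R where "R = {h. continuous_on ?T h \<and> (\<lambda>x. complex_of_real (h (torus_map x))) \<in> trig_poly}"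
  obtain \<Phi> where \<Phi>: "continuous_on ?T \<Phi>" "\<And>x. \<Phi> (torus_map x) = \<phi> x"
    by (rule continuous_factor_torus[OF assms(1,2)]) (rule that)
  have RI: "h \<in> R" if "continuous_on ?T h" "\<And>x. complex_of_real (h (torus_map x)) = c * torus_char k x + d * torus_char l x" for h c d k l
  proof -
    have "(\<lambda>x. complex_of_real (h (torus_map x))) = (\<lambda>x. c * torus_char k x + d * torus_char l x)"
      using that(2) by auto
    then show ?thesis using that(1) by (simp add: R_def trig_poly.intros)
  qed
  \<comment> \<open>Real and imaginary parts are combinations of a coordinate and its conjugate, and
    these pull back to the characters with frequencies \<open>axis j 1\<close> and
    \<open>- axis j 1\<close>.\<close>
  have Re: "(\<lambda>w. Re (w $ j)) \<in> R" for j
    by (rule RI[of _ "1/2" "axis j 1" "1/2" "- axis j 1"])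
       (auto intro!: continuous_intros simp: torus_map_def torus_char_uminus torus_char_axis_left complex_eq_iff)
  have Im: "(\<lambda>w. Im (w $ j)) \<in> R" for j
    by (rule RI[of _ "- \<i>/2" "axis j 1" "\<i>/2" "- axis j 1"])
       (auto intro!: continuous_intros simp: torus_map_def torus_char_uminus torus_char_axis_left complex_eq_iff)
  interpret function_ring_on R ?T
  proof
    show "compact ?T"
      unfolding range_torus_map by (intro compact_continuous_image continuous_on_torus_map compact_cbox)
    show "continuous_on ?T h" if "h \<in> R" for h
      using that by (simp add: R_def)
    show "(\<lambda>x. h x + h' x) \<in> R" if "h \<in> R" "h' \<in> R" for h h'
      using that by (simp add: R_def trig_poly.add continuous_on_add)
    show "(\<lambda>x. h x * h' x) \<in> R" if "h \<in> R" "h' \<in> R" for h h'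
      using that by (simp add: R_def trig_poly_mult continuous_on_mult)
    show "(\<lambda>_. c) \<in> R" for c
      by (simp add: R_def trig_poly_const)
  next
    fix x y :: "complex ^ 'd"
    assume "x \<in> ?T" "y \<in> ?T" "x \<noteq> y"
    show "\<exists>h\<in>R. h x \<noteq> h y"
    proof -
      from \<open>x \<noteq> y\<close> obtain j where "x $ j \<noteq> y $ j" by (auto simp: vec_eq_iff)
      then have "Re (x $ j) \<noteq> Re (y $ j) \<or> Im (x $ j) \<noteq> Im (y $ j)" by (simp add: complex_eq_iff)
      then show ?thesis
        using bexI[of "\<lambda>h. h x \<noteq> h y", OF _ Re[of j]] bexI[of "\<lambda>h. h x \<noteq> h y", OF _ Im[of j]]
        by (elim disjE)
    qed
  qed
  obtain h where h: "h \<in> R" "\<forall>w\<in>?T. \<bar>\<Phi> w - h w\<bar> < e"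
    using Stone_Weierstrass_basic[OF \<Phi>(1) assms(3)] by auto
  show thesis
  proof (rule that)
    show "(\<lambda>x. complex_of_real (h (torus_map x))) \<in> trig_poly" using h(1) by (simp add: R_def)
    show "norm (complex_of_real (\<phi> x) - complex_of_real (h (torus_map x))) < e" for x
    proof -
      have "\<bar>\<Phi> (torus_map x) - h (torus_map x)\<bar> < e" using h(2) by simp
      then show ?thesis by (simp add: \<Phi>(2) flip: of_real_diff)
    qed
  qed
qed

section \<open>Uniqueness of Fourier coefficients\<close>

lemma set_integral_norm_bound_le:
  fixes g h :: "real ^ 'd \<Rightarrow> complex"
  assumes "continuous_on UNIV g" "continuous_on UNIV h" "\<And>x. norm (h x) \<le> e"
  shows "norm (LINT x:unit_cube|lborel. g x * h x) \<le> e * (LINT x:unit_cube|lborel. norm (g x))"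
proof -
  have "norm (LINT x:unit_cube|lborel. g x * h x) \<le> (LINT x:unit_cube|lborel. norm (g x * h x))"
    unfolding set_lebesgue_integral_def
    by (rule order_trans[OF integral_norm_bound]) (simp add: indicator_def)
  also have "\<dots> \<le> (LINT x:unit_cube|lborel. e * norm (g x))"
    using assms by (intro set_integral_mono set_integrable_unit_cube continuous_intros)
      (auto simp: norm_mult mult.commute[of e] intro!: mult_left_mono)
  finally show ?thesis by simp
qed

text \<open>The half-open and the closed cube differ by part of the frontier, a negligible set, so
  the corresponding fact for closed boxes applies.\<close>

lemma set_integral_eq_0_imp_eq_0:
  fixes \<phi> :: "real ^ 'd \<Rightarrow> real"
  assumes cont: "continuous_on UNIV \<phi>" and nn: "\<And>x. 0 \<le> \<phi> x"
    and int: "(LINT x:unit_cube|lborel. \<phi> x) = 0" and x: "x \<in> unit_cube"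
  shows "\<phi> x = 0"
proof -
  have "(\<phi> has_integral 0) unit_cube"
    using set_borel_integral_eq_integral[OF set_integrable_unit_cube[OF cont]] int
    by (simp add: has_integral_integrable_integral)
  then have "(\<phi> has_integral 0) (cbox 0 1)"
    by (rule has_integral_spike_set_eq[THEN iffD1, rotated -1])
       (rule negligible_subset[OF negligible_frontier_interval[of 0 "1 :: real ^ 'd"]],
         use unit_cube_subset_cbox box_subset_unit_cube in blast)+
  moreover have "box 0 (1 :: real ^ 'd) \<noteq> {}" by (simp add: box_ne_empty Basis_vec_def inner_axis)
  ultimately show ?thesis
    using has_integral_0_cbox_imp_0[of 0 1 \<phi> x] continuous_on_subset[OF cont] nn x unit_cube_subset_cbox
    by blast
qed

lemma fourier_coeff_eq: "fourier_coeff f k = (LINT x:unit_cube|lborel. f x * torus_char (- k) x)"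
  by (simp add: fourier_coeff_def exp_wn_inner torus_char_uminus)

text \<open>The integral of \<open>g\<close> against every trigonometric polynomial vanishes, hence
  by approximation also against every real continuous periodic function. Testing with the real and
  imaginary parts of \<open>g\<close> shows that the squared modulus has integral 0.\<close>

lemma fourier_uniqueness:
  fixes g :: "real ^ 'd \<Rightarrow> complex"
  assumes cont: "continuous_on UNIV g" and per: "periodic g" and zero: "\<And>k. fourier_coeff g k = 0"
  shows "g x = 0"
proof -
  have poly: "(LINT x:unit_cube|lborel. g x * p x) = 0" if "p \<in> trig_poly" for p
    using that
  proof induction
    case (torus_char c k)
    have "(LINT x:unit_cube|lborel. g x * (c * torus_char k x)) = c * fourier_coeff g (- k)"
      by (simp add: fourier_coeff_eq mult.left_commute[of _ c] flip: set_integral_mult_right)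
    then show ?case by (simp add: zero)
  next
    case (add p q)
    then show ?case
      by (simp add: distrib_left set_integral_add set_integrable_unit_cube cont continuous_on_trig_poly continuous_on_mult)
  qed
  have real: "(LINT x:unit_cube|lborel. g x * of_real (\<phi> x)) = 0"
    if "continuous_on UNIV \<phi>" "periodic \<phi>" for \<phi> :: "real ^ 'd \<Rightarrow> real"
  proof -
    let ?I = "LINT x:unit_cube|lborel. g x * of_real (\<phi> x)"
    let ?C = "LINT x:unit_cube|lborel. norm (g x)"
    have "norm ?I \<le> e * ?C" if "e > 0" for e
    proof -
      obtain p where p: "p \<in> trig_poly" "\<And>x. norm (of_real (\<phi> x) - p x) < e"
        by (rule trig_poly_approx[OF \<open>continuous_on UNIV \<phi>\<close> \<open>periodic \<phi>\<close> \<open>e > 0\<close>]) (rule that)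
      have "(LINT x:unit_cube|lborel. g x * (of_real (\<phi> x) - p x)) = ?I"
        unfolding right_diff_distrib
        using \<open>continuous_on UNIV \<phi>\<close> continuous_on_trig_poly[OF p(1)]
        by (subst set_integral_diff) (auto intro!: set_integrable_unit_cube continuous_intros cont simp: poly[OF p(1)])
      moreover have "norm (LINT x:unit_cube|lborel. g x * (of_real (\<phi> x) - p x)) \<le> e * ?C"
        using p \<open>continuous_on UNIV \<phi>\<close>
        by (intro set_integral_norm_bound_le cont continuous_intros continuous_on_trig_poly) (auto intro: less_imp_le)
      ultimately show ?thesis by simp
    qed
    then have "\<forall>\<^sub>F e in at_right 0. norm ?I \<le> e * ?C"
      by (simp add: eventually_at_filter)
    moreover have "((\<lambda>e. e * ?C) \<longlongrightarrow> 0 * ?C) (at_right 0)"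
      by (intro tendsto_intros)
    ultimately have "norm ?I \<le> 0 * ?C"
      using tendsto_le[OF trivial_limit_at_right_real _ tendsto_const] by blast
    then show ?thesis by simp
  qed
  have perR: "periodic (\<lambda>x. Re (g x))" "periodic (\<lambda>x. Im (g x))"
    using per by (simp_all add: periodic_def)
  \<comment> \<open>This is \<open>g\<close> times its conjugate, the conjugate being written as
    real part minus \<i> times imaginary part.\<close>
  have "of_real ((norm (g x))\<^sup>2) = g x * of_real (Re (g x)) - \<i> * (g x * of_real (Im (g x)))" for x
    by (simp only: cmod_power2) (simp add: complex_eq_iff power2_eq_square)
  then have "(LINT x:unit_cube|lborel. complex_of_real ((norm (g x))\<^sup>2))
    = (LINT x:unit_cube|lborel. g x * of_real (Re (g x)) - \<i> * (g x * of_real (Im (g x))))"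
    by (simp only:)
  also have "\<dots> = (LINT x:unit_cube|lborel. g x * of_real (Re (g x))) - \<i> * (LINT x:unit_cube|lborel. g x * of_real (Im (g x)))"
    by (subst set_integral_diff) (auto intro!: set_integrable_unit_cube continuous_intros cont)
  also have "\<dots> = 0"
    using perR by (simp add: real continuous_on_Re continuous_on_Im cont)
  finally have "(LINT x:unit_cube|lborel. (norm (g x))\<^sup>2) = 0"
    unfolding set_integral_complex_of_real by simp
  then have "(norm (g y))\<^sup>2 = 0" if "y \<in> unit_cube" for y
    using that by (intro set_integral_eq_0_imp_eq_0[where \<phi> = "\<lambda>x. (norm (g x))\<^sup>2"] continuous_intros cont) auto
  then have "g (\<chi> j. frac (x $ j)) = 0" using frac_in_unit_cube by fastforce
  then show ?thesis using periodic_eq_frac[OF per] by metis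
qed

section \<open>Absolutely convergent Fourier series\<close>

lemma fourier_coeff_torus_char_sum:
  assumes "finite F"
  shows "fourier_coeff (\<lambda>x. \<Sum>k\<in>F. c k * torus_char k x) l = (if l \<in> F then c l else 0)"
proof -
  have "fourier_coeff (\<lambda>x. \<Sum>k\<in>F. c k * torus_char k x) l = (LINT x:unit_cube|lborel. (\<Sum>k\<in>F. c k * torus_char (k - l) x))"
    by (simp add: fourier_coeff_eq torus_char_diff torus_char_uminus sum_distrib_right mult.assoc)
  also have "\<dots> = (\<Sum>k\<in>F. LINT x:unit_cube|lborel. c k * torus_char (k - l) x)"
    unfolding set_lebesgue_integral_def scaleR_sum_right
    by (intro Bochner_Integration.integral_sum set_integrable_unit_cube[unfolded set_integrable_def] continuous_intros)
  also have "\<dots> = (\<Sum>k\<in>F. if k = l then c l else 0)"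
    by (intro sum.cong) (auto simp: integral_torus_char)
  finally show ?thesis using assms by simp
qed

lemma fourier_coeff_diff:
  assumes "continuous_on UNIV f" "continuous_on UNIV g"
  shows "fourier_coeff (\<lambda>x. f x - g x) k = fourier_coeff f k - fourier_coeff g k"
  unfolding fourier_coeff_eq left_diff_distrib
  using assms by (intro set_integral_diff set_integrable_unit_cube continuous_intros)

text \<open>The cube has volume 1. Through this estimate, uniform convergence passes to Fourier
  coefficients in \<open>fourier_inversion\<close>.\<close>

lemma norm_fourier_coeff_le:
  assumes "continuous_on UNIV f" "\<And>x. norm (f x) \<le> e"
  shows "norm (fourier_coeff f k) \<le> e"
proof -
  have "norm (fourier_coeff f k) \<le> e * (LINT x:unit_cube|lborel. norm (torus_char (- k) x))"
    unfolding fourier_coeff_eq mult.commute[of "f _"]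
    by (intro set_integral_norm_bound_le continuous_intros assms)
  also have "(LINT x:unit_cube|lborel. norm (torus_char (- k) x)) = 1"
    by (simp add: set_lebesgue_integral_def measure_def emeasure_unit_cube)
  finally show ?thesis by simp
qed

text \<open>By the Weierstrass M-test the series converges uniformly to a continuous periodic
  \<open>h\<close>. Its coefficients are those of \<open>f\<close>, so uniqueness applied to
  \<open>f - h\<close> gives the claim.\<close>

theorem fourier_inversion:
  fixes f :: "real ^ 'd \<Rightarrow> complex"
  assumes cont: "continuous_on UNIV f" and per: "periodic f"
    and summ: "(\<lambda>k. norm (fourier_coeff f k)) summable_on UNIV"
  shows "((\<lambda>k. fourier_coeff f k * torus_char k x) has_sum f x) UNIV"
proof -
  let ?t = "\<lambda>k x. fourier_coeff f k * torus_char k x"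
  define h where "h x = (\<Sum>\<^sub>\<infinity>k. ?t k x)" for x
  have lim: "uniform_limit UNIV (\<lambda>F x. \<Sum>k\<in>F. ?t k x) h (finite_subsets_at_top UNIV)"
    unfolding h_def by (rule Weierstrass_m_test_general[OF _ summ]) (simp add: norm_mult)
  have hs: "((\<lambda>k. ?t k x) has_sum h x) UNIV" for x
    unfolding has_sum_def by (rule tendsto_uniform_limitI[OF lim]) simp
  have cont_h: "continuous_on UNIV h"
    by (rule uniform_limit_theorem[OF _ lim]) (auto intro!: always_eventually continuous_intros)
  have per_h: "periodic h"
  proof -
    have "torus_char k (y + axis j 1) = torus_char k y" for k :: "int ^ 'd" and y j
      using periodic_torus_char[of k] by (auto simp: periodic_def)
    then show ?thesis by (simp add: periodic_def h_def)
  qed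
  have "fourier_coeff h l = fourier_coeff f l" for l
  proof -
    have "norm (fourier_coeff f l - fourier_coeff h l) \<le> e" if "e > 0" for e
    proof -
      have "\<forall>\<^sub>F F in finite_subsets_at_top UNIV. \<forall>x\<in>UNIV. dist (\<Sum>k\<in>F. ?t k x) (h x) < e"
        using lim \<open>e > 0\<close> by (simp add: uniform_limit_iff)
      then obtain X where X: "finite X"
        "\<And>Y. finite Y \<Longrightarrow> X \<subseteq> Y \<Longrightarrow> \<forall>x\<in>UNIV. dist (\<Sum>k\<in>Y. ?t k x) (h x) < e"
        unfolding eventually_finite_subsets_at_top by auto
      \<comment> \<open>Including \<open>l\<close> ensures that the partial sum over
        \<open>F\<close> already has the same coefficient at \<open>l\<close> as
        \<open>f\<close>.\<close>
      define F where "F = insert l X"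
      have F: "finite F" "l \<in> F" using X(1) by (simp_all add: F_def)
      have less: "norm ((\<Sum>k\<in>F. ?t k x) - h x) < e" for x
        using X(2)[OF F(1)] by (auto simp: F_def dist_norm)
      have "fourier_coeff f l - fourier_coeff h l = fourier_coeff (\<lambda>x. (\<Sum>k\<in>F. ?t k x) - h x) l"
        using F by (subst fourier_coeff_diff) (auto intro!: continuous_intros cont_h simp: fourier_coeff_torus_char_sum)
      also have "norm \<dots> \<le> e"
        using less by (intro norm_fourier_coeff_le continuous_intros cont_h less_imp_le)
      finally show ?thesis .
    qed
    then have "norm (fourier_coeff f l - fourier_coeff h l) \<le> 0"
      by (meson dense_ge)
    then show ?thesis by simp
  qed
  then have "f x - h x = 0"
    using per per_h by (intro fourier_uniqueness[where g = "\<lambda>x. f x - h x"] continuous_intros cont cont_h)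
      (simp_all add: periodic_def fourier_coeff_diff cont cont_h)
  then show ?thesis using hs[of x] by simp
qed


subsection \<open>Wavenumbers and the dual lattice\<close>

text \<open>\<open>lin_num b a m k\<close> is the integer \<open>b\<^bsup>m+1\<^esup> k\<^sup>T z\<close> for \<open>z = z_pow b a m\<close>: unlike \<open>nu\<close>, it is additive in \<open>k\<close>.\<close>

definition lin_num :: "nat \<Rightarrow> (nat \<Rightarrow> int ^ 'd) \<Rightarrow> nat \<Rightarrow> int ^ 'd \<Rightarrow> int" where
  "lin_num b a m k = (\<Sum>j\<in>UNIV. k $ j * (\<Sum>i\<le>m. int (b ^ i) * a i $ j))"

lemma z_pow_eq:
  assumes "b > 0"
  shows "z_pow b a m $ j = real_of_int (\<Sum>i\<le>m. int (b ^ i) * a i $ j) / real (b ^ Suc m)"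
  using assms by (induction m) (simp_all add: field_simps)

lemma lin_num_diff: "lin_num b a m (k - h) = lin_num b a m k - lin_num b a m h"
  by (simp add: lin_num_def left_diff_distrib sum_subtractf)

lemma inner_z_pow:
  assumes "b > 0"
  shows "(\<Sum>j\<in>UNIV. real_of_int (k $ j) * z_pow b a m $ j) = real_of_int (lin_num b a m k) / real (b ^ Suc m)"
proof -
  have "real_of_int (k $ j) * z_pow b a m $ j
      = real_of_int (k $ j * (\<Sum>i\<le>m. int (b ^ i) * a i $ j)) / real (b ^ Suc m)" for j
    unfolding z_pow_eq[OF assms] of_int_mult times_divide_eq_right ..
  then show ?thesis by (simp add: lin_num_def flip: sum_divide_distrib)
qed

text \<open>Multiplying the fractional part of N / B by B leaves N mod B. In this form
  \<open>nu\<close> is visibly the residue of an additive map.\<close>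

lemma nu_eq_mod:
  assumes "b > 0"
  shows "int (nu b a (Suc m) k) = lin_num b a m k mod int (b ^ Suc m)"
proof -
  let ?N = "lin_num b a m k" and ?B = "int (b ^ Suc m)"
  have B: "?B > 0" using assms by simp
  have "real (nu b a (Suc m) k) = real_of_int ?B * frac (real_of_int ?N / real_of_int ?B)"
    unfolding nu_Suc[OF assms] wn_inner_def inner_z_pow[OF assms] by simp
  also have "\<dots> = real_of_int (?N - ?B * (?N div ?B))"
  proof -
    have "\<lfloor>real_of_int ?N / real_of_int ?B\<rfloor> = ?N div ?B" by (rule floor_divide_of_int_eq)
    then show ?thesis using assms unfolding frac_def
      by (simp only: right_diff_distrib of_int_diff of_int_mult) simp
  qed
  also have "?N - ?B * (?N div ?B) = ?N mod ?B"
    by (simp add: minus_mult_div_eq_mod)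
  finally show ?thesis by linarith
qed

text \<open>The numerators \<open>lin_num\<close> at levels n and n + 1 differ by a multiple of
  \<open>b ^ Suc n\<close>. The residues are thus nested, each new level adding one top
  digit.\<close>

lemma nu_Suc_mod:
  assumes "b > 0"
  shows "nu b a (Suc m) k mod b ^ m = nu b a m k"
proof (cases m)
  case (Suc n)
  have "lin_num b a (Suc n) k = lin_num b a n k + int (b ^ Suc n) * (\<Sum>j\<in>UNIV. k $ j * a (Suc n) $ j)"
    by (simp add: lin_num_def distrib_left sum.distrib sum_distrib_left mult_ac)
  then have "lin_num b a (Suc n) k mod int (b ^ Suc n) = lin_num b a n k mod int (b ^ Suc n)"
    by simp
  moreover have "int (b ^ Suc n) dvd int (b ^ Suc (Suc n))" by simp
  ultimately have "int (nu b a (Suc (Suc n)) k) mod int (b ^ Suc n) = int (nu b a (Suc n) k)"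
    unfolding nu_eq_mod[OF assms] by (simp only: mod_mod_cancel)
  then show ?thesis unfolding Suc by (simp only: flip: of_nat_mod of_nat_eq_iff)
qed (simp add: nu_0)

lemma nu_mod:
  assumes "b > 0" "m \<le> n"
  shows "nu b a n k mod b ^ m = nu b a m k"
  using assms(2)
proof (induction n rule: dec_induct)
  case base
  then show ?case by (rule mod_less[OF nu_less[OF assms(1)]])
next
  case (step n)
  have "nu b a (Suc n) k mod b ^ m = nu b a (Suc n) k mod b ^ n mod b ^ m"
    using step.hyps by (simp add: mod_mod_cancel le_imp_power_dvd)
  then show ?case using step nu_Suc_mod[OF assms(1)] by metis
qed

text \<open>The kernel of \<open>nu b a m\<close> is the dual lattice of level \<open>m\<close>, and
  equal wavenumbers mean equal cosets of it.\<close>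

lemma nu_eq_iff:
  assumes "b > 0"
  shows "nu b a m k = nu b a m h \<longleftrightarrow> nu b a m (k - h) = 0"
proof (cases m)
  case (Suc n)
  have "nu b a m k = nu b a m h \<longleftrightarrow> int (nu b a m k) = int (nu b a m h)" by simp
  also have "\<dots> \<longleftrightarrow> int (nu b a m (k - h)) = 0"
    unfolding Suc nu_eq_mod[OF assms] lin_num_diff by (simp only: mod_eq_dvd_iff dvd_eq_mod_eq_0)
  finally show ?thesis by simp
qed (simp add: nu_0)

section \<open>Character sums over the lattice points\<close>

lemma torus_char_z_pow:
  assumes "b > 0"
  shows "torus_char k (z_pow b a m) = cis (2 * pi * (real (nu b a (Suc m) k) / real (b ^ Suc m)))"
proof -
  have "real (nu b a (Suc m) k) / real (b ^ Suc m) = wn_inner k (z_pow b a m)"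
    unfolding nu_Suc[OF assms] using assms by simp
  then show ?thesis by (simp add: torus_char_def wn_inner_def cis_frac)
qed

lemma torus_char_scaleR: "torus_char k (real n *\<^sub>R x) = torus_char k x ^ n"
proof (induction n)
  case (Suc n)
  then show ?case by (simp add: scaleR_left_distrib torus_char_add_right)
qed (simp add: torus_char_def)

lemma torus_char_sum: "torus_char k (\<Sum>l\<in>A. x l) = (\<Prod>l\<in>A. torus_char k (x l))"
proof (induction A rule: infinite_finite_induct)
  case (insert l A)
  then show ?case by (simp add: torus_char_add_right)
qed (simp_all add: torus_char_def)

text \<open>A character ignores the reduction modulo 1 and turns the digit sum into a product. An
  index below \<open>b ^ m\<close> has no nonzero digit from position \<open>m\<close> on.\<close>

lemma torus_char_z_pt:
  assumes b: "b \<ge> 2" and i: "i < b ^ m"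
  shows "torus_char k (z_pt b a i) = (\<Prod>l<m. torus_char k (z_pow b a l) ^ digit b i l)"
proof -
  have sub: "{l. digit b i l \<noteq> 0} \<subseteq> {..<m}"
  proof
    fix l assume "l \<in> {l. digit b i l \<noteq> 0}"
    then have "i div b ^ l \<noteq> 0" unfolding digit_def by (auto intro!: Nat.gr0I)
    then have "b ^ l \<le> i" by (metis div_less not_le)
    then have "b ^ l < b ^ m" using i by simp
    then show "l \<in> {..<m}" using b by (simp add: power_less_imp_less_exp)
  qed
  have "(\<Sum>l | digit b i l \<noteq> 0. real (digit b i l) * z_pow b a l $ j)
      = (\<Sum>l<m. real (digit b i l) *\<^sub>R z_pow b a l) $ j" for j
    using sub by (simp, intro sum.mono_neutral_left) auto
  then have "torus_char k (z_pt b a i) = torus_char k (\<Sum>l<m. real (digit b i l) *\<^sub>R z_pow b a l)"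
    unfolding z_pt_def by (simp only: torus_char_frac)
  then show ?thesis by (simp add: torus_char_sum torus_char_scaleR)
qed

lemma sum_lessThan_power_Suc:
  fixes g :: "nat \<Rightarrow> 'a :: comm_monoid_add"
  shows "(\<Sum>i<b ^ Suc m. g i) = (\<Sum>c<b. \<Sum>\<kappa><b ^ m. g (\<kappa> + c * b ^ m))"
  using sum.nat_group[of g "b ^ m" b]
  by (simp add: mult.commute atLeast0LessThan[symmetric] add.commute flip: sum.shift_bounds_nat_ivl)

text \<open>Splitting off the top digit factors the sum into the sum of the previous level and a
  geometric sum in \<open>w\<close>. When the previous level has wavenumber 0, \<open>w\<close> is a
  \<open>b\<close>-th root of unity, equal to 1 exactly if the next wavenumber is also 0.\<close>

lemma sum_torus_char_z_pt:
  assumes b: "b \<ge> 2"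
  shows "(\<Sum>i<b ^ m. torus_char k (z_pt b a i)) = (if nu b a m k = 0 then of_nat (b ^ m) else 0)"
proof (induction m)
  case 0
  then show ?case using torus_char_z_pt[OF b, of 0 0] by (simp add: nu_0)
next
  case (Suc m)
  have b0: "b > 0" using b by simp
  define w where "w = torus_char k (z_pow b a m)"
  have "torus_char k (z_pt b a (\<kappa> + c * b ^ m)) = torus_char k (z_pt b a \<kappa>) * w ^ c" if "\<kappa> < b ^ m" "c < b" for \<kappa> c
  proof -
    have "\<kappa> + c * b ^ m < b ^ m + c * b ^ m" using that by simp
    also have "\<dots> = Suc c * b ^ m" by simp
    also have "\<dots> \<le> b * b ^ m" using that by (intro mult_right_mono) auto
    finally have lt: "\<kappa> + c * b ^ m < b ^ Suc m" by simp
    have d: "digit b (\<kappa> + c * b ^ m) l = digit b \<kappa> l" if "l < m" for l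
    proof -
      \<comment> \<open>The top part is a multiple of \<open>b ^ Suc l\<close>, so it does not
        affect digit \<open>l\<close>.\<close>
      have e: "c * b ^ m = b ^ l * (b * (c * b ^ (m - Suc l)))"
        using that by (simp flip: power_add power_Suc)
      show ?thesis unfolding digit_def e using b0 by simp
    qed
    have d': "digit b (\<kappa> + c * b ^ m) m = c"
      unfolding digit_def using that b0 by simp
    have "(\<Prod>l<m. torus_char k (z_pow b a l) ^ digit b (\<kappa> + c * b ^ m) l) = (\<Prod>l<m. torus_char k (z_pow b a l) ^ digit b \<kappa> l)"
      by (intro prod.cong) (auto simp: d)
    then show ?thesis
      by (simp add: torus_char_z_pt[OF b lt] torus_char_z_pt[OF b that(1)] d' w_def)
  qed
  then have "(\<Sum>i<b ^ Suc m. torus_char k (z_pt b a i)) = (\<Sum>c<b. \<Sum>\<kappa><b ^ m. torus_char k (z_pt b a \<kappa>) * w ^ c)"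
    unfolding sum_lessThan_power_Suc by (intro sum.cong refl) auto
  also have "\<dots> = (\<Sum>\<kappa><b ^ m. torus_char k (z_pt b a \<kappa>)) * (\<Sum>c<b. w ^ c)"
    by (simp add: sum_product sum.swap[of _ "{..<b}"])
  finally have eq: "(\<Sum>i<b ^ Suc m. torus_char k (z_pt b a i)) = \<dots>" .
  show ?case
  proof (cases "nu b a m k = 0")
    case False
    then have "nu b a (Suc m) k \<noteq> 0" using nu_Suc_mod[OF b0, of a m k] by (metis mod_0)
    then show ?thesis using eq Suc False by simp
  next
    case True
    then obtain c where c: "nu b a (Suc m) k = c * b ^ m"
      using nu_Suc_mod[OF b0, of a m k] by (auto simp: mod_eq_0_iff_dvd dvd_def mult.commute)
    have "c * b ^ m < b * b ^ m" using nu_less[OF b0, of a "Suc m" k] c by simp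
    then have "c < b" by simp
    have w: "w = cis (2 * pi * (real c / real b))"
      unfolding w_def torus_char_z_pow[OF b0] c using b0 by simp
    show ?thesis
    proof (cases "c = 0")
      case True
      then show ?thesis using eq Suc \<open>nu b a m k = 0\<close> c w by simp
    next
      case False
      have "w ^ b = 1"
      proof -
        have "real b * (2 * pi * (real c / real b)) = 2 * pi * real c" using b0 by simp
        then show ?thesis unfolding w Complex.DeMoivre by (simp only:) simp
      qed
      moreover have "w \<noteq> 1"
      proof
        assume "w = 1"
        then have "cos (2 * pi * (real c / real b)) = 1" by (simp add: w complex_eq_iff)
        then obtain n :: int where "2 * pi * (real c / real b) = of_int n * 2 * pi"
          using cos_one_2pi_int by blast
        then have "real c = of_int n * real b" using b0 by (simp add: field_simps)
        then have "int c = n * int b" by (metis of_int_eq_iff of_int_mult of_int_of_nat_eq)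
        then have "b dvd c" by (metis dvd_triv_right int_dvd_int_iff)
        then show False using \<open>c < b\<close> False by (auto dest: dvd_imp_le)
      qed
      ultimately have "(\<Sum>c<b. w ^ c) = 0"
        using sum_gp_strict[of w b] by simp
      then show ?thesis using eq c False b0 by simp
    qed
  qed
qed

text \<open>The recursion permutes the digits: \<open>\<pi>\<close> swaps \<open>0\<close> with the new digit of \<open>kt \<kappa>\<close>.\<close>

lemma wavenumber_map_Suc:
  assumes b: "b \<ge> 2" and kt: "wavenumber_map b a kt" and \<kappa>: "\<kappa> < b ^ m"
  obtains \<pi> where "inj_on \<pi> {..<b}"
    "\<And>c. c < b \<Longrightarrow> nu b a (Suc m) (kt (\<kappa> + c * b ^ m)) = nu b a m (kt \<kappa>) + \<pi> c * b ^ m"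
proof -
  obtain c where c: "c < b" "nu b a (Suc m) (kt \<kappa>) = nu b a m (kt \<kappa>) + c * b ^ m"
    "c \<noteq> 0 \<Longrightarrow> nu b a (Suc m) (kt (\<kappa> + c * b ^ m)) = nu b a m (kt \<kappa>)"
    "\<And>c'. c' \<in> {1..b - 1} - {c} \<Longrightarrow>
        nu b a (Suc m) (kt (\<kappa> + c' * b ^ m)) = nu b a m (kt \<kappa>) + c' * b ^ m"
    using kt \<kappa> unfolding wavenumber_map_def by metis
  \<comment> \<open>For \<open>c = 0\<close> both updates send 0 to 0 and \<open>\<pi>\<close> is
    the identity, so that case is covered as well.\<close>
  define \<pi> where "\<pi> = id(0 := c, c := 0)"
  have "inj_on \<pi> {..<b}" by (auto simp: \<pi>_def inj_on_def)
  moreover have "nu b a (Suc m) (kt (\<kappa> + c' * b ^ m)) = nu b a m (kt \<kappa>) + \<pi> c' * b ^ m" if "c' < b" for c'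
    using c(2,3) c(4)[of c'] that by (cases "c' = 0"; cases "c' = c") (auto simp: \<pi>_def)
  ultimately show thesis by (rule that)
qed

text \<open>By the recursion the wavenumbers of \<open>n\<close> and \<open>n mod b ^ M\<close>
  agree modulo \<open>b ^ M\<close>. Digits at positions from \<open>m\<close> on can thus be
  stripped one at a time, starting at the top.\<close>

lemma nu_wavenumber_mod:
  assumes b: "b \<ge> 2" and kt: "wavenumber_map b a kt"
  shows "nu b a m (kt n) = nu b a m (kt (n mod b ^ m))"
proof -
  have b0: "b > 0" using b by simp
  have "n < b ^ M \<Longrightarrow> nu b a m (kt n) = nu b a m (kt (n mod b ^ m))" if "m \<le> M" for n M
    using that
  proof (induction M arbitrary: n rule: dec_induct)
    case (step M)
    define \<kappa> c where "\<kappa> = n mod b ^ M" and "c = n div b ^ M"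
    have n: "n = \<kappa> + c * b ^ M" unfolding \<kappa>_def c_def by (metis mod_div_mult_eq)
    have \<kappa>: "\<kappa> < b ^ M" using b0 by (simp add: \<kappa>_def)
    have "c < b" using step.prems by (simp add: c_def less_mult_imp_div_less)
    then obtain p where p: "nu b a (Suc M) (kt n) = nu b a M (kt \<kappa>) + p * b ^ M"
      using wavenumber_map_Suc[OF b kt \<kappa>] n by metis
    have "nu b a m (kt n) = nu b a (Suc M) (kt n) mod b ^ M mod b ^ m"
      using nu_mod[OF b0, of m "M" a] nu_Suc_mod[OF b0] step.hyps(1) by metis
    also have "\<dots> = nu b a M (kt \<kappa>) mod b ^ m"
      unfolding p using nu_less[OF b0, of a M] by simp
    also have "\<dots> = nu b a m (kt \<kappa>)" using nu_mod[OF b0 step.hyps(1)] .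
    also have "\<dots> = nu b a m (kt (n mod b ^ m))"
      using step.IH[OF \<kappa>] step.hyps(1) by (simp add: \<kappa>_def mod_mod_cancel le_imp_power_dvd)
    finally show ?case .
  qed simp
  \<comment> \<open>The induction needs some power of \<open>b\<close> above \<open>n\<close> with
    exponent at least \<open>m\<close>.\<close>
  moreover have "n < b ^ max m n"
  proof -
    have "n < 2 ^ n" by (rule less_exp)
    also have "\<dots> \<le> b ^ n" using b by (intro power_mono) auto
    also have "\<dots> \<le> b ^ max m n" using b by (intro power_increasing) auto
    finally show ?thesis .
  qed
  ultimately show ?thesis by (metis max.cobounded1)
qed

text \<open>Equal wavenumbers at level m + 1 agree at level m, so by induction the lower digits of
  the indices coincide. The top digits then coincide because the digit permutation is
  injective.\<close>

lemma inj_on_nu_wavenumber: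
  assumes b: "b \<ge> 2" and kt: "wavenumber_map b a kt"
  shows "inj_on (\<lambda>\<kappa>. nu b a m (kt \<kappa>)) {..<b ^ m}"
proof (induction m)
  case 0
  then show ?case by (simp add: inj_on_def)
next
  case (Suc m)
  have b0: "b > 0" using b by simp
  show ?case
  proof (rule inj_onI)
    fix n n' assume "n \<in> {..<b ^ Suc m}" "n' \<in> {..<b ^ Suc m}"
      and eq: "nu b a (Suc m) (kt n) = nu b a (Suc m) (kt n')"
    then have c: "n div b ^ m < b" "n' div b ^ m < b" by (simp_all add: less_mult_imp_div_less)
    have "nu b a m (kt (n mod b ^ m)) = nu b a m (kt (n' mod b ^ m))"
      using eq nu_Suc_mod[OF b0] nu_wavenumber_mod[OF b kt] by metis
    then have mod: "n mod b ^ m = n' mod b ^ m"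
      using Suc b0 by (auto dest: inj_onD)
    have "n mod b ^ m < b ^ m" using b0 by simp
    then obtain \<pi> where inj: "inj_on \<pi> {..<b}" and
      \<pi>: "\<And>c. c < b \<Longrightarrow> nu b a (Suc m) (kt (n mod b ^ m + c * b ^ m)) = nu b a m (kt (n mod b ^ m)) + \<pi> c * b ^ m"
      using wavenumber_map_Suc[OF b kt] by metis
    have "nu b a m (kt (n mod b ^ m)) + \<pi> (n div b ^ m) * b ^ m = nu b a m (kt (n mod b ^ m)) + \<pi> (n' div b ^ m) * b ^ m"
      using \<pi>[OF c(1)] \<pi>[OF c(2)] eq mod by (metis mod_div_mult_eq)
    then have "\<pi> (n div b ^ m) = \<pi> (n' div b ^ m)" using b0 by simp
    then have "n div b ^ m = n' div b ^ m" using inj c by (auto dest: inj_onD)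
    then show "n = n'" using mod by (metis mod_div_mult_eq)
  qed
qed

text \<open>Cosets of the dual lattice are matched with residue classes modulo \<open>b ^ m\<close>.
  This is why the aliased indices form an arithmetic progression.\<close>

lemma nu_wavenumber_eq_iff:
  assumes b: "b \<ge> 2" and kt: "wavenumber_map b a kt" and \<kappa>: "\<kappa> < b ^ m"
  shows "nu b a m (kt n) = nu b a m (kt \<kappa>) \<longleftrightarrow> n mod b ^ m = \<kappa>"
proof -
  have "n mod b ^ m < b ^ m" using b by simp
  then have "nu b a m (kt (n mod b ^ m)) = nu b a m (kt \<kappa>) \<longleftrightarrow> n mod b ^ m = \<kappa>"
    using inj_on_nu_wavenumber[OF b kt, of m] \<kappa> by (auto dest: inj_onD)
  then show ?thesis using nu_wavenumber_mod[OF b kt, of m n] by simp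
qed


subsection \<open>Aliasing\<close>

lemma has_sum_sum_finite:
  fixes f :: "'i \<Rightarrow> 'a \<Rightarrow> 'b :: topological_comm_monoid_add"
  assumes "\<And>i. i \<in> I \<Longrightarrow> (f i has_sum s i) A"
  shows "((\<lambda>x. \<Sum>i\<in>I. f i x) has_sum (\<Sum>i\<in>I. s i)) A"
proof -
  have "sum (\<lambda>x. \<Sum>i\<in>I. f i x) = (\<lambda>F. \<Sum>i\<in>I. sum (f i) F)"
    by (rule ext) (rule sum.swap)
  then show ?thesis using assms unfolding has_sum_def by (simp only:) (rule tendsto_sum)
qed

lemma integrand_fourier_series:
  fixes f :: "real ^ 'd \<Rightarrow> complex"
  assumes f: "integrand f" and kt: "bij kt"
  shows "((\<lambda>n :: nat. fourier_coeff f (kt n) * torus_char (kt n) x) has_sum f x) UNIV"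
proof -
  have "((\<lambda>k. fourier_coeff f k * torus_char k x) has_sum f x) UNIV"
    using f by (intro fourier_inversion) (auto simp: integrand_def absolutely_continuous_cube_def periodic_def)
  then show ?thesis using has_sum_reindex_bij_betw[OF kt, of "\<lambda>k. fourier_coeff f k * torus_char k x"] by simp
qed

lemma integrand_summable:
  assumes "integrand f" "bij kt"
  shows "(\<lambda>n :: nat. norm (fourier_coeff f (kt n))) summable_on A"
proof -
  have "(\<lambda>n. norm (fourier_coeff f (kt n))) summable_on UNIV"
    using assms summable_on_reindex_bij_betw[of kt UNIV UNIV "\<lambda>k. norm (fourier_coeff f k)"]
    by (simp add: integrand_def)
  then show ?thesis by (rule summable_on_subset_banach) simp
qed

text \<open>The Fourier series is inserted into the lattice average. The shift \<Delta> comes out as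
  a phase, and the remaining character sum is \<open>b ^ m\<close> or 0 according to whether
  \<open>kt n - kt \<kappa>\<close> lies in the dual lattice.\<close>

lemma discrete_coeff_has_sum:
  assumes b: "b \<ge> 2" and kt: "wavenumber_map b a kt" and f: "integrand f" and \<kappa>: "\<kappa> < b ^ m"
  shows "((\<lambda>n. if n mod b ^ m = \<kappa> then fourier_coeff f (kt n) * torus_char (kt n - kt \<kappa>) \<Delta> else 0)
     has_sum discrete_coeff b a \<Delta> m f (kt \<kappa>)) UNIV"
proof -
  have b0: "b > 0" using b by simp
  have bij: "bij kt" using kt by (simp add: wavenumber_map_def)
  let ?k = "kt \<kappa>"
  define x where "x i = oplus (z_pt b a i) \<Delta>" for i
  have "((\<lambda>n. inverse (of_nat (b ^ m)) * (\<Sum>i<b ^ m. cnj (torus_char ?k (x i)) * (fourier_coeff f (kt n) * torus_char (kt n) (x i))))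
    has_sum inverse (of_nat (b ^ m)) * (\<Sum>i<b ^ m. cnj (torus_char ?k (x i)) * f (x i))) UNIV"
    by (intro has_sum_cmult_right has_sum_sum_finite integrand_fourier_series[OF f bij])
  moreover have "inverse (of_nat (b ^ m)) * (\<Sum>i<b ^ m. cnj (torus_char ?k (x i)) * (fourier_coeff f (kt n) * torus_char (kt n) (x i)))
    = (if n mod b ^ m = \<kappa> then fourier_coeff f (kt n) * torus_char (kt n - ?k) \<Delta> else 0)" for n
  proof -
    have "(\<Sum>i<b ^ m. cnj (torus_char ?k (x i)) * (fourier_coeff f (kt n) * torus_char (kt n) (x i)))
      = (\<Sum>i<b ^ m. fourier_coeff f (kt n) * torus_char (kt n - ?k) \<Delta> * torus_char (kt n - ?k) (z_pt b a i))"
      unfolding x_def torus_char_oplus torus_char_diff by (intro sum.cong) simp_all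
    also have "\<dots> = fourier_coeff f (kt n) * torus_char (kt n - ?k) \<Delta> * (if nu b a m (kt n - ?k) = 0 then of_nat (b ^ m) else 0)"
      by (simp only: sum_torus_char_z_pt[OF b] flip: sum_distrib_left)
    also have "nu b a m (kt n - ?k) = 0 \<longleftrightarrow> n mod b ^ m = \<kappa>"
      using nu_wavenumber_eq_iff[OF b kt \<kappa>] nu_eq_iff[OF b0] by metis
    finally show ?thesis using b0 by simp
  qed
  moreover have "inverse (of_nat (b ^ m)) * (\<Sum>i<b ^ m. cnj (torus_char ?k (x i)) * f (x i)) = discrete_coeff b a \<Delta> m f ?k"
    unfolding discrete_coeff_def exp_wn_inner x_def by (simp add: field_simps)
  ultimately show ?thesis by simp
qed

text \<open>In the series for the discrete coefficient, the term of index \<kappa> has phase 1 and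
  is the true coefficient. The other terms carry phases of modulus 1, so the triangle inequality
  applies.\<close>

lemma aliasing_bound:
  assumes b: "b \<ge> 2" and kt: "wavenumber_map b a kt" and f: "integrand f" and \<kappa>: "\<kappa> < b ^ m"
  shows "norm (fourier_coeff f (kt \<kappa>) - discrete_coeff b a \<Delta> m f (kt \<kappa>))
    \<le> (\<Sum>\<^sub>\<infinity>n\<in>{1..}. norm (fourier_coeff f (kt (\<kappa> + n * b ^ m))))"
proof -
  have b0: "b > 0" using b by simp
  have bij: "bij kt" using kt by (simp add: wavenumber_map_def)
  let ?c = "\<lambda>n. fourier_coeff f (kt n)" and ?h = "\<lambda>n. \<kappa> + n * b ^ m"
  define t where "t n = ?c n * torus_char (kt n - kt \<kappa>) \<Delta>" for n
  have inj: "inj_on ?h A" for A using b0 by (auto simp: inj_on_def)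
  have "n mod b ^ m = \<kappa> \<longleftrightarrow> n \<in> range ?h" for n
  proof
    assume "n mod b ^ m = \<kappa>"
    then have "n = ?h (n div b ^ m)" by (metis mod_div_mult_eq)
    then show "n \<in> range ?h" by blast
  qed (use \<kappa> in auto)
  then have "(t has_sum discrete_coeff b a \<Delta> m f (kt \<kappa>)) (range ?h)"
    using discrete_coeff_has_sum[OF b kt f \<kappa>, of \<Delta>]
    by (subst has_sum_cong_neutral[of UNIV _ "\<lambda>n. if n mod b ^ m = \<kappa> then ?c n * torus_char (kt n - kt \<kappa>) \<Delta> else 0"])
      (auto simp: t_def)
  moreover have "(t has_sum ?c \<kappa>) {\<kappa>}"
    using has_sum_finite[of "{\<kappa>}" t] by (simp add: t_def)
  moreover have "{\<kappa>} \<subseteq> range ?h" by auto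
  ultimately have "(t has_sum (discrete_coeff b a \<Delta> m f (kt \<kappa>) - ?c \<kappa>)) (range ?h - {\<kappa>})"
    by (rule has_sum_Diff)
  moreover have "range ?h - {\<kappa>} = ?h ` {1..}"
    using b0 by (auto simp: image_iff Suc_le_eq intro: gr0I)
  ultimately have "((\<lambda>n. t (?h n)) has_sum (discrete_coeff b a \<Delta> m f (kt \<kappa>) - ?c \<kappa>)) {1..}"
    by (simp add: has_sum_reindex[OF inj] o_def)
  moreover have "((\<lambda>n. norm (?c (?h n))) has_sum (\<Sum>\<^sub>\<infinity>n\<in>{1..}. norm (?c (?h n)))) {1..}"
    using integrand_summable[OF f bij, of "?h ` {1..}"]
    by (intro has_sum_infsum) (simp add: summable_on_reindex[OF inj] o_def)
  ultimately have "norm (discrete_coeff b a \<Delta> m f (kt \<kappa>) - ?c \<kappa>) \<le> (\<Sum>\<^sub>\<infinity>n\<in>{1..}. norm (?c (?h n)))"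
    by (rule norm_infsum_le) (simp add: t_def norm_mult)
  then show ?thesis by (simp add: norm_minus_commute)
qed

section \<open>Index blocks and the error bound\<close>

lemma block_subset:
  assumes "b > 0"
  shows "block b l \<subseteq> {..<b ^ l}"
proof
  fix n assume "n \<in> block b l"
  then have "n \<le> b ^ l - 1" by (simp add: block_def)
  moreover have "b ^ l > 0" using assms by simp
  ultimately show "n \<in> {..<b ^ l}" unfolding lessThan_iff by linarith
qed

text \<open>The lower end is the floor of 1 / b, which is 0 as b is at least 2. Hence
  \<open>S_hat\<close> at level 0 is the aliasing series of index 0 alone.\<close>

lemma block_0:
  assumes "b \<ge> 2"
  shows "block b 0 = {0}"
proof -
  have "\<lfloor>real b powi (int 0 - 1)\<rfloor> = 0"
    using assms by (simp add: power_int_minus floor_eq_iff field_simps)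
  then show ?thesis by (simp add: block_def)
qed

theorem mainTheorem3:
  fixes b :: nat
    and a :: "nat \<Rightarrow> int ^ 'd"
    and \<Delta> :: "real ^ 'd"
    and kt :: "nat \<Rightarrow> int ^ 'd"
    and lstar l m :: nat
    and \<omega>hat \<omega>ring :: "nat \<Rightarrow> real"
    and f :: "real ^ 'd \<Rightarrow> complex"
  assumes "prime b"
    and "lattice_generator b a"
    and "\<Delta> \<in> unit_cube"
    and "wavenumber_map b a kt"
    and "cone_parameters lstar \<omega>hat \<omega>ring"
    and "f \<in> integrand_cone b kt lstar \<omega>hat \<omega>ring"
    and "lstar \<le> l" and "l \<le> m"
    and "\<omega>hat (m - l) * \<omega>ring (m - l) < 1"
  shows "norm ((LINT x:unit_cube|lborel. f x) - cubature b a \<Delta> m f)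
    \<le> \<omega>hat m * \<omega>ring (m - l) / (1 - \<omega>hat (m - l) * \<omega>ring (m - l)) * S_tilde b a \<Delta> kt l m f"
proof -
  have b: "b \<ge> 2" using \<open>prime b\<close> by (rule prime_ge_2_nat)
  then have b0: "b > 0" by simp
  note kt = \<open>wavenumber_map b a kt\<close>
  have kt0: "kt 0 = 0" using kt by (simp add: wavenumber_map_def)
  have f: "integrand f"
    and hat: "\<And>l m. l \<le> m \<Longrightarrow> S_hat b kt l m f \<le> \<omega>hat (m - l) * S_check b kt m f"
    and check: "S_check b kt m f \<le> \<omega>ring (m - l) * S_sum b kt l f"
    using \<open>f \<in> _\<close> \<open>lstar \<le> l\<close> \<open>l \<le> m\<close> by (auto simp: integrand_cone_def)
  have nonneg: "0 \<le> \<omega>hat n" "0 \<le> \<omega>ring n" for n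
    using \<open>cone_parameters _ _ _\<close> by (auto simp: cone_parameters_def)
  note bound = aliasing_bound[OF b kt f]
  define q where "q = \<omega>hat (m - l) * \<omega>ring (m - l)"
  have q: "q < 1" unfolding q_def by fact

  \<comment> \<open>Indices in the block lie below \<open>b ^ l\<close>, hence below
    \<open>b ^ m\<close>, so the aliasing bound of level \<open>m\<close> applies to each.\<close>
  have "S_sum b kt l f \<le> (\<Sum>\<kappa>\<in>block b l. norm (discrete_coeff b a \<Delta> m f (kt \<kappa>))
      + (\<Sum>\<^sub>\<infinity>n\<in>{1..}. norm (fourier_coeff f (kt (\<kappa> + n * b ^ m)))))"
    unfolding S_sum_def
  proof (rule sum_mono)
    fix \<kappa> assume "\<kappa> \<in> block b l"
    then have "\<kappa> < b ^ l" using block_subset[OF b0] by auto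
    also have "\<dots> \<le> b ^ m" using b \<open>l \<le> m\<close> by (intro power_increasing) auto
    finally have "norm (fourier_coeff f (kt \<kappa>) - discrete_coeff b a \<Delta> m f (kt \<kappa>))
      \<le> (\<Sum>\<^sub>\<infinity>n\<in>{1..}. norm (fourier_coeff f (kt (\<kappa> + n * b ^ m))))"
      by (rule bound)
    then show "norm (fourier_coeff f (kt \<kappa>)) \<le> norm (discrete_coeff b a \<Delta> m f (kt \<kappa>))
      + (\<Sum>\<^sub>\<infinity>n\<in>{1..}. norm (fourier_coeff f (kt (\<kappa> + n * b ^ m))))"
      by norm
  qed
  also have "\<dots> = S_tilde b a \<Delta> kt l m f + S_hat b kt l m f"
    by (simp add: S_tilde_def S_hat_def sum.distrib)
  finally have "S_sum b kt l f \<le> S_tilde b a \<Delta> kt l m f + S_hat b kt l m f" .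
  moreover have "S_hat b kt l m f \<le> \<omega>hat (m - l) * S_check b kt m f"
    using hat \<open>l \<le> m\<close> .
  moreover have "\<dots> \<le> \<omega>hat (m - l) * (\<omega>ring (m - l) * S_sum b kt l f)"
    by (intro mult_left_mono check nonneg)
  \<comment> \<open>\<open>S_sum\<close> bounds itself with factor \<open>q\<close>; absorbing that
    term on the left is useful because \<open>q < 1\<close>.\<close>
  ultimately have "S_sum b kt l f * (1 - q) \<le> S_tilde b a \<Delta> kt l m f"
    by (simp add: q_def algebra_simps)
  then have S_le: "S_sum b kt l f \<le> S_tilde b a \<Delta> kt l m f / (1 - q)"
    using q by (simp add: pos_le_divide_eq)

  \<comment> \<open>Since \<open>kt 0 = 0\<close>, the cubature error is the aliasing error of the
    coefficient with index 0.\<close>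
  have "(LINT x:unit_cube|lborel. f x) = fourier_coeff f (kt 0)"
    by (simp add: fourier_coeff_eq kt0)
  moreover have "cubature b a \<Delta> m f = discrete_coeff b a \<Delta> m f (kt 0)"
    by (simp add: cubature_def discrete_coeff_def kt0 exp_wn_inner)
  ultimately have "norm ((LINT x:unit_cube|lborel. f x) - cubature b a \<Delta> m f)
      \<le> (\<Sum>\<^sub>\<infinity>n\<in>{1..}. norm (fourier_coeff f (kt (0 + n * b ^ m))))"
    using bound[of 0 m \<Delta>] b0 by simp
  also have "\<dots> = S_hat b kt 0 m f"
    by (simp add: S_hat_def block_0[OF b])
  \<comment> \<open>The first cone condition is now taken at level 0, which produces
    \<open>\<omega>hat m\<close> in place of \<open>\<omega>hat (m - l)\<close>.\<close>
  also have "\<dots> \<le> \<omega>hat m * S_check b kt m f"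
    using hat[of 0 m] by simp
  also have "\<dots> \<le> \<omega>hat m * (\<omega>ring (m - l) * S_sum b kt l f)"
    by (intro mult_left_mono check nonneg)
  also have "\<dots> \<le> \<omega>hat m * (\<omega>ring (m - l) * (S_tilde b a \<Delta> kt l m f / (1 - q)))"
    using S_le nonneg by (intro mult_left_mono) auto
  finally show ?thesis by (simp add: q_def)
qed

end
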